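(* Let $\mathbb{T}$ be a time scale, $a,b\in\mathbb{T}$ with $a<b$, $t\in(a,b]_{\mathbb{T}}$, and $0\le\alpha\le 1$. Let $w,f,g\in C([a,b]_{\mathbb{T}},\mathbb{R})$ be diamond-$\alpha$ integrable functions and let $K:[a,b]_{\mathbb{T}}\times[a,b]_{\mathbb{T}}\to[0,\infty)$ be a nonnegative kernel. Assume that all the integrals appearing below exist and are finite. Assume that \[ \mathcal{I}_{K}^{\alpha}(|w|)(t)=1, \] and that there exist constants $m,M,n,N>0$ such that \[ 0<m\leq|f(s)|\leq M<\infty,\qquad 0<n\leq|g(s)|\leq N<\infty \] for all $s\in[a,t]_{\mathbb{T}}$. Then \[ \begin{aligned} 0&\leq\Big[\mathcal{I}_{K}^{\alpha}(|w||f|^2)(t)\Big]^{1/2}\Big[\mathcal{I}_{K}^{\alpha}(|w||g|^2)(t)\Big]^{1/2}-\mathcal{I}_{K}^{\alpha}(|w||f||g|)(t)\\ &\leq\frac12\left[\max\left\{\frac{M}{m},\frac{N}{n}\right\}-\min\left\{\frac{m}{M},\frac{n}{N}\right\}\right]^2\Big[\mathcal{I}_{K}^{\alpha}(|w||f|^2)(t)\Big]^{1/2}\Big[\mathcal{I}_{K}^{\alpha}(|w||g|^2)(t)\Big]^{1/2}. \end{aligned} \]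
   Context: A time scale $\mathbb{T}$ is a nonempty closed subset of $\mathbb{R}$. For $a,b\in\mathbb{T}$, $[a,b]_{\mathbb{T}}=[a,b]\cap\mathbb{T}$ and $(a,b]_{\mathbb{T}}=(a,b]\cap\mathbb{T}$. For $0\le\alpha\le1$ and $h$ delta and nabla integrable on $[a,b]_{\mathbb{T}}$, the diamond-$\alpha$ integral is \[ \int_a^b h(s)\diamond_\alpha s=\alpha\int_a^b h(s)\,\Delta s+(1-\alpha)\int_a^b h(s)\,\nabla s, \] where $\int\cdot\,\Delta s$ and $\int\cdot\,\nabla s$ are the usual delta and nabla integrals of time scale calculus. For a nonnegative kernel $K:[a,b]_{\mathbb{T}}\times[a,b]_{\mathbb{T}}\to[0,\infty)$ and a suitable function $h:[a,b]_{\mathbb{T}}\to\mathbb{R}$, the kernel-type diamond-$\alpha$ integral operator is \[ \mathcal{I}_{K}^{\alpha}h(t)=\int_a^t K(t,s)h(s)\diamond_\alpha s, \] provided that the integral exists and is finite. An expression such as $|w||f|^2$ denotes the function $s\mapsto|w(s)||f(s)|^2$. *)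

theory Defs
  imports "HOL-Analysis.Analysis"
begin

definition time_scale :: "real set \<Rightarrow> bool" where
  "time_scale T \<longleftrightarrow> closed T \<and> T \<noteq> {}"

text \<open>
  The delta and nabla integrals are taken in the Lebesgue sense: the delta (nabla) measure is the
  Caratheodory measure on \<open>T\<close> generated by assigning the length \<open>d - c\<close> to the intervals
  \<open>[c,d)\<close> (respectively \<open>(c,d]\<close>) of \<open>T\<close> with endpoints \<open>c \<le> d\<close> in \<open>T\<close>. These integrals extend
  the Riemann delta and nabla integrals, hence also the Cauchy integrals of regulated functions.
\<close>

definition delta_interval :: "real set \<Rightarrow> real \<Rightarrow> real \<Rightarrow> real set" where
  "delta_interval T c d = {c..<d} \<inter> T"

definition nabla_interval :: "real set \<Rightarrow> real \<Rightarrow> real \<Rightarrow> real set" where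
  "nabla_interval T c d = {c<..d} \<inter> T"

text \<open>
  Infimum over countable covers by intervals \<open>J c d\<close> (finite covers arise from \<open>c i = d i\<close>). It is
  \<open>\<infinity>\<close> when there is no cover, e.g. for the delta outer measure of \<open>{Max T}\<close>.
\<close>

definition length_outer :: "real set \<Rightarrow> (real \<Rightarrow> real \<Rightarrow> real set) \<Rightarrow> real set \<Rightarrow> ennreal" where
  "length_outer T J E =
     (INF (c, d) \<in> {(c, d). (\<forall>i::nat. c i \<in> T \<and> d i \<in> T \<and> c i \<le> d i) \<and> E \<subseteq> (\<Union>i. J (c i) (d i))}.
        \<Sum>i. ennreal (d i - c i))"

definition caratheodory_measure :: "real set \<Rightarrow> (real set \<Rightarrow> ennreal) \<Rightarrow> real measure" where
  "caratheodory_measure T \<mu> = measure_of T (lambda_system T (Pow T) \<mu>) \<mu>"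

definition delta_measure :: "real set \<Rightarrow> real measure" where
  "delta_measure T = caratheodory_measure T (length_outer T (delta_interval T))"

definition nabla_measure :: "real set \<Rightarrow> real measure" where
  "nabla_measure T = caratheodory_measure T (length_outer T (nabla_interval T))"

text \<open>
  All integrals below are meant for \<open>a, b \<in> T\<close> with \<open>a \<le> b\<close>.
\<close>

definition delta_integrable :: "real set \<Rightarrow> real \<Rightarrow> real \<Rightarrow> (real \<Rightarrow> real) \<Rightarrow> bool" where
  "delta_integrable T a b h \<longleftrightarrow> set_integrable (delta_measure T) (delta_interval T a b) h"

definition nabla_integrable :: "real set \<Rightarrow> real \<Rightarrow> real \<Rightarrow> (real \<Rightarrow> real) \<Rightarrow> bool" where
  "nabla_integrable T a b h \<longleftrightarrow> set_integrable (nabla_measure T) (nabla_interval T a b) h"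

definition delta_integral :: "real set \<Rightarrow> real \<Rightarrow> real \<Rightarrow> (real \<Rightarrow> real) \<Rightarrow> real" where
  "delta_integral T a b h = (LINT s:delta_interval T a b|delta_measure T. h s)"

definition nabla_integral :: "real set \<Rightarrow> real \<Rightarrow> real \<Rightarrow> (real \<Rightarrow> real) \<Rightarrow> real" where
  "nabla_integral T a b h = (LINT s:nabla_interval T a b|nabla_measure T. h s)"

text \<open>
  Integrability is required for both constituents, also in the extreme cases \<open>\<alpha> = 0\<close> and \<open>\<alpha> = 1\<close>,
  so it does not depend on \<open>\<alpha>\<close>.
\<close>

definition diamond_integrable :: "real set \<Rightarrow> real \<Rightarrow> real \<Rightarrow> (real \<Rightarrow> real) \<Rightarrow> bool" where
  "diamond_integrable T a b h \<longleftrightarrow> delta_integrable T a b h \<and> nabla_integrable T a b h"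

definition diamond_integral :: "real \<Rightarrow> real set \<Rightarrow> real \<Rightarrow> real \<Rightarrow> (real \<Rightarrow> real) \<Rightarrow> real" where
  "diamond_integral \<alpha> T a b h = \<alpha> * delta_integral T a b h + (1 - \<alpha>) * nabla_integral T a b h"

definition kernel_integral ::
    "real \<Rightarrow> real set \<Rightarrow> real \<Rightarrow> (real \<Rightarrow> real \<Rightarrow> real) \<Rightarrow> (real \<Rightarrow> real) \<Rightarrow> real \<Rightarrow> real" where
  "kernel_integral \<alpha> T a K h t = diamond_integral \<alpha> T a t (\<lambda>s. K t s * h s)"

definition kernel_integral_exists ::
    "real set \<Rightarrow> real \<Rightarrow> (real \<Rightarrow> real \<Rightarrow> real) \<Rightarrow> (real \<Rightarrow> real) \<Rightarrow> real \<Rightarrow> bool" where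
  "kernel_integral_exists T a K h t \<longleftrightarrow> diamond_integrable T a t (\<lambda>s. K t s * h s)"

text \<open>
  The remaining facts confirm that the two measures are the intended ones: on a time scale the
  intervals \<open>[p,q)\<close> (respectively \<open>(p,q]\<close>) are measurable and have measure \<open>q - p\<close>.
\<close>

lemma length_outer_le:
  assumes "\<And>i::nat. c i \<in> T" "\<And>i. d i \<in> T" "\<And>i. c i \<le> d i" "E \<subseteq> (\<Union>i. J (c i) (d i))"
  shows "length_outer T J E \<le> (\<Sum>i. ennreal (d i - c i))"
  unfolding length_outer_def by (rule INF_lower2[of "(c, d)"]) (use assms in auto)

lemma length_outer_less:
  assumes "length_outer T J E < x"
  shows "\<exists>c d. (\<forall>i::nat. c i \<in> T \<and> d i \<in> T \<and> c i \<le> d i) \<and> E \<subseteq> (\<Union>i. J (c i) (d i))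
           \<and> (\<Sum>i. ennreal (d i - c i)) < x"
  using assms unfolding length_outer_def INF_less_iff by auto

lemma length_outer_space:
  assumes "T \<noteq> {}" and J0: "\<And>c. J c c = {}"
  shows "outer_measure_space (Pow T) (length_outer T J)"
  unfolding outer_measure_space_def
proof (intro conjI)
  obtain p where p: "p \<in> T" using assms by auto
  have "length_outer T J {} \<le> (\<Sum>i. ennreal (p - p))"
    by (rule length_outer_le) (use p in auto)
  then show "positive (Pow T) (length_outer T J)" by (simp add: positive_def)
  show "increasing (Pow T) (length_outer T J)"
    unfolding increasing_def length_outer_def by (intro ballI impI INF_superset_mono) auto
  show "countably_subadditive (Pow T) (length_outer T J)"
  proof (simp add: countably_subadditive_def, safe)
    fix A :: "nat \<Rightarrow> real set"
    let ?O = "length_outer T J"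
    show "?O (\<Union>i. A i) \<le> (\<Sum>n. ?O (A n))"
    proof (rule ennreal_le_epsilon)
      fix b and e :: real assume "0 < e" "(\<Sum>n. ?O (A n)) < top"
      then have *: "\<And>n. ?O (A n) < ?O (A n) + e * (1/2)^Suc n"
        by (auto simp add: less_top dest!: ennreal_suminf_lessD)
      define P where "P n c d \<longleftrightarrow> (\<forall>i::nat. c i \<in> T \<and> d i \<in> T \<and> c i \<le> d i) \<and>
          A n \<subseteq> (\<Union>i. J (c i) (d i)) \<and>
          (\<Sum>i. ennreal (d i - c i)) < ?O (A n) + e * (1/2)^Suc n" for n c d
      have "\<exists>c d. P n c d" for n
        using length_outer_less[OF *[of n]] unfolding P_def .
      then obtain c d where "\<And>n. P n (c n) (d n)" by metis
      then have cd: "\<And>n i::nat. c n i \<in> T" "\<And>n i. d n i \<in> T" "\<And>n i. c n i \<le> d n i"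
        "\<And>n. A n \<subseteq> (\<Union>i. J (c n i) (d n i))"
        "\<And>n. (\<Sum>i. ennreal (d n i - c n i)) < ?O (A n) + e * (1/2)^Suc n"
        unfolding P_def by blast+
      define c' where "c' k = (case prod_decode k of (n,i) \<Rightarrow> c n i)" for k
      define d' where "d' k = (case prod_decode k of (n,i) \<Rightarrow> d n i)" for k
      have "?O (\<Union>i. A i) \<le> (\<Sum>k. ennreal (d' k - c' k))"
      proof (rule length_outer_le)
        show "\<Union> (range A) \<subseteq> (\<Union>i. J (c' i) (d' i))"
        proof
          fix x assume "x \<in> \<Union> (range A)"
          then obtain n i where "x \<in> J (c n i) (d n i)" using cd(4) by blast
          then have "x \<in> J (c' (prod_encode (n,i))) (d' (prod_encode (n,i)))"
            by (simp add: c'_def d'_def)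
          then show "x \<in> (\<Union>i. J (c' i) (d' i))" by blast
        qed
      qed (auto simp: c'_def d'_def cd split: prod.splits)
      also have "\<dots> = (\<Sum>k. (\<lambda>(n,i). ennreal (d n i - c n i)) (prod_decode k))"
        by (simp add: c'_def d'_def split_def)
      also have "\<dots> = (\<Sum>n. \<Sum>i. ennreal (d n i - c n i))"
        by (rule suminf_ennreal_2dimen) simp
      also have "\<dots> \<le> (\<Sum>n. ?O (A n) + e * (1/2) ^ Suc n)"
        using cd(5) by (intro suminf_le) (auto intro: less_imp_le)
      also have "... = (\<Sum>n. ?O (A n)) + (\<Sum>n. ennreal e * ennreal ((1/2) ^ Suc n))"
        using \<open>0 < e\<close> by (subst suminf_add[symmetric])
                       (auto simp del: ennreal_suminf_cmult simp add: ennreal_mult[symmetric])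
      also have "\<dots> = (\<Sum>n. ?O (A n)) + e"
        unfolding ennreal_suminf_cmult
        by (subst suminf_ennreal_eq[OF zero_le_power power_half_series]) auto
      finally show "?O (\<Union>i. A i) \<le> (\<Sum>n. ?O (A n)) + e" .
    qed
  qed
qed

lemma sets_caratheodory:
  assumes "outer_measure_space (Pow T) \<mu>"
  shows "sets (caratheodory_measure T \<mu>) = lambda_system T (Pow T) \<mu>"
    and "L \<in> lambda_system T (Pow T) \<mu> \<Longrightarrow> emeasure (caratheodory_measure T \<mu>) L = \<mu> L"
proof -
  have ms: "measure_space T (lambda_system T (Pow T) \<mu>) \<mu>"
    using sigma_algebra.caratheodory_lemma[OF sigma_algebra_Pow assms] .
  then interpret sigma_algebra T "lambda_system T (Pow T) \<mu>" by (simp add: measure_space_def)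
  show "sets (caratheodory_measure T \<mu>) = lambda_system T (Pow T) \<mu>"
    by (simp add: caratheodory_measure_def)
  show "emeasure (caratheodory_measure T \<mu>) L = \<mu> L" if "L \<in> lambda_system T (Pow T) \<mu>"
    unfolding caratheodory_measure_def
    using ms that by (subst emeasure_measure_of_sigma) (auto simp: measure_space_def)
qed

lemma split_measurable:
  assumes T: "T \<noteq> {}" and J0: "\<And>c. J c c = {}" and L: "L \<subseteq> T"
    and split: "\<And>c d. c \<in> T \<Longrightarrow> d \<in> T \<Longrightarrow> c \<le> d \<Longrightarrow>
      \<exists>m\<in>T. c \<le> m \<and> m \<le> d \<and> J c d \<inter> L \<subseteq> J c m \<and> J c d - L \<subseteq> J m d"
  shows "L \<in> lambda_system T (Pow T) (length_outer T J)"
proof -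
  let ?O = "length_outer T J"
  interpret Pow: sigma_algebra T "Pow T" by (rule sigma_algebra_Pow)
  note oms = length_outer_space[of T J, OF T J0]
  have sub: "subadditive (Pow T) ?O"
    using oms Pow.countably_subadditive_subadditive unfolding outer_measure_space_def by blast
  have "?O (x \<inter> L) + ?O (x - L) = ?O x" if x: "x \<subseteq> T" for x
  proof (rule antisym)
    have "?O x = ?O ((x \<inter> L) \<union> (x - L))" by (rule arg_cong[of _ _ ?O]) auto
    also have "\<dots> \<le> ?O (x \<inter> L) + ?O (x - L)"
      by (rule subadditiveD[OF sub]) (use x in auto)
    finally show "?O x \<le> ?O (x \<inter> L) + ?O (x - L)" .
    show "?O (x \<inter> L) + ?O (x - L) \<le> ?O x"
      unfolding length_outer_def[of T J x]
    proof (safe intro!: INF_greatest)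
      fix c d :: "nat \<Rightarrow> real"
      assume cd: "\<forall>i. c i \<in> T \<and> d i \<in> T \<and> c i \<le> d i" and xs: "x \<subseteq> (\<Union>i. J (c i) (d i))"
      have "\<forall>i. \<exists>m\<in>T. c i \<le> m \<and> m \<le> d i \<and> J (c i) (d i) \<inter> L \<subseteq> J (c i) m \<and> J (c i) (d i) - L \<subseteq> J m (d i)"
        using split cd by blast
      then obtain m where m: "\<And>i. m i \<in> T" "\<And>i. c i \<le> m i" "\<And>i. m i \<le> d i"
        "\<And>i. J (c i) (d i) \<inter> L \<subseteq> J (c i) (m i)" "\<And>i. J (c i) (d i) - L \<subseteq> J (m i) (d i)"
        by metis
      have "?O (x \<inter> L) \<le> (\<Sum>i. ennreal (m i - c i))"
        proof (rule length_outer_le)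
        show "x \<inter> L \<subseteq> (\<Union>i. J (c i) (m i))"
        proof
          fix y assume y: "y \<in> x \<inter> L"
          then obtain i where "y \<in> J (c i) (d i)" using xs by blast
          then show "y \<in> (\<Union>i. J (c i) (m i))" using m(4)[of i] y by blast
        qed
      qed (use cd m in auto)
      moreover have "?O (x - L) \<le> (\<Sum>i. ennreal (d i - m i))"
        proof (rule length_outer_le)
        show "x - L \<subseteq> (\<Union>i. J (m i) (d i))"
        proof
          fix y assume y: "y \<in> x - L"
          then obtain i where "y \<in> J (c i) (d i)" using xs by blast
          then show "y \<in> (\<Union>i. J (m i) (d i))" using m(5)[of i] y by blast
        qed
      qed (use cd m in auto)
      ultimately have "?O (x \<inter> L) + ?O (x - L) \<le> (\<Sum>i. ennreal (m i - c i)) + (\<Sum>i. ennreal (d i - m i))"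
        by (rule add_mono)
      also have "\<dots> = (\<Sum>i. ennreal (m i - c i) + ennreal (d i - m i))"
        by (rule suminf_add) auto
      also have "\<dots> = (\<Sum>i. ennreal (d i - c i))"
        by (rule suminf_cong) (use m in \<open>simp add: ennreal_plus[symmetric] del: ennreal_plus\<close>)
      finally show "?O (x \<inter> L) + ?O (x - L) \<le> (\<Sum>i. ennreal (d i - c i))" .
    qed
  qed
  then show ?thesis
    using L by (auto simp: Pow.lambda_system_eq)
qed

lemma length_outer_interval:
  assumes "p \<in> T" "q \<in> T" "p \<le> q" and J0: "\<And>c. J c c = {}" and I: "I \<in> sets lborel" "emeasure lborel I = ennreal (q - p)"
    and I': "\<And>c d. c \<le> d \<Longrightarrow> I' c d \<in> sets lborel" "\<And>c d. c \<le> d \<Longrightarrow> emeasure lborel (I' c d) = ennreal (d - c)"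
    and fill: "\<And>x. x \<in> I \<Longrightarrow> \<exists>y\<in>J p q. \<forall>c\<in>T. \<forall>d\<in>T. y \<in> J c d \<longrightarrow> x \<in> I' c d"
  shows "length_outer T J (J p q) = ennreal (q - p)"
proof (rule antisym)
  have "length_outer T J (J p q) \<le> (\<Sum>i. ennreal ((if i = 0 then q else p) - p))"
    by (rule length_outer_le) (use assms in \<open>auto intro!: exI[of _ "0::nat"]\<close>)
  also have "\<dots> = (\<Sum>i\<in>{0::nat}. ennreal ((if i = 0 then q else p) - p))"
    by (rule suminf_finite) auto
  finally show "length_outer T J (J p q) \<le> ennreal (q - p)" by simp
  show "ennreal (q - p) \<le> length_outer T J (J p q)"
    unfolding length_outer_def
  proof (safe intro!: INF_greatest)
    fix c d :: "nat \<Rightarrow> real"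
    assume cd: "\<forall>i. c i \<in> T \<and> d i \<in> T \<and> c i \<le> d i" and s: "J p q \<subseteq> (\<Union>i. J (c i) (d i))"
    have "I \<subseteq> (\<Union>i. I' (c i) (d i))"
    proof
      fix x assume "x \<in> I"
      then obtain y where y: "y \<in> J p q" "\<forall>c\<in>T. \<forall>d\<in>T. y \<in> J c d \<longrightarrow> x \<in> I' c d" using fill by blast
      then obtain i where "y \<in> J (c i) (d i)" using s by blast
      then show "x \<in> (\<Union>i. I' (c i) (d i))" using y cd by blast
    qed
    then have "emeasure lborel I \<le> emeasure lborel (\<Union>i. I' (c i) (d i))"
      by (rule emeasure_mono) (use I' cd in auto)
    also have "\<dots> \<le> (\<Sum>i. emeasure lborel (I' (c i) (d i)))"
      by (rule emeasure_subadditive_countably) (use I' cd in auto)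
    also have "\<dots> = (\<Sum>i. ennreal (d i - c i))"
      by (rule suminf_cong) (use I' cd in auto)
    finally show "ennreal (q - p) \<le> (\<Sum>i. ennreal (d i - c i))" using I by simp
  qed
qed

lemma delta_measure_interval:
  assumes "time_scale T" "p \<in> T" "q \<in> T" "p \<le> q"
  shows "delta_interval T p q \<in> sets (delta_measure T)"
    and "emeasure (delta_measure T) (delta_interval T p q) = ennreal (q - p)"
proof -
  let ?J = "delta_interval T"
  have T: "T \<noteq> {}" "closed T" using assms by (auto simp: time_scale_def)
  have J0: "\<And>c. ?J c c = {}" by (auto simp: delta_interval_def)
  note oms = length_outer_space[of T ?J, OF T(1) J0]
  have meas: "{x\<in>T. x < r} \<in> sets (delta_measure T)" if "r \<in> T" for r
    unfolding delta_measure_def sets_caratheodory(1)[OF oms]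
  proof (rule split_measurable[OF T(1) J0])
    fix c d assume "c \<in> T" "d \<in> T" "c \<le> d"
    then show "\<exists>m\<in>T. c \<le> m \<and> m \<le> d \<and> ?J c d \<inter> {x \<in> T. x < r} \<subseteq> ?J c m
         \<and> ?J c d - {x \<in> T. x < r} \<subseteq> ?J m d"
      using that by (intro bexI[of _ "max c (min d r)"]) (auto simp: delta_interval_def max_def min_def)
  qed auto
  have "?J p q = {x\<in>T. x < q} - {x\<in>T. x < p}" by (auto simp: delta_interval_def)
  then show m: "?J p q \<in> sets (delta_measure T)" using meas assms by auto
  have "emeasure (delta_measure T) (?J p q) = length_outer T ?J (?J p q)"
    using m unfolding delta_measure_def by (simp add: sets_caratheodory[OF oms])
  also have "\<dots> = ennreal (q - p)"
  proof (rule length_outer_interval[where I = "{p..<q}" and I' = "\<lambda>c d. {c..<d}"])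
    fix x assume x: "x \<in> {p..<q}"
    define y where "y = Sup (T \<inter> {p..x})"
    have ne: "T \<inter> {p..x} \<noteq> {}" using x assms by auto
    have bd: "bdd_above (T \<inter> {p..x})" by (rule bdd_above_mono[OF bdd_above_Icc Int_lower2])
    have cl: "closed (T \<inter> {p..x})" by (intro closed_Int T closed_atLeastAtMost)
    have y: "y \<in> T \<inter> {p..x}" unfolding y_def by (rule closed_contains_Sup[OF ne bd cl])
    have up: "z \<le> y" if "z \<in> T" "z \<in> {p..x}" for z
      unfolding y_def using that bd by (intro cSup_upper) auto
    show "\<exists>y\<in>?J p q. \<forall>c\<in>T. \<forall>d\<in>T. y \<in> ?J c d \<longrightarrow> x \<in> {c..<d}"
    proof (intro bexI[of _ y] ballI impI)
      show "y \<in> ?J p q" using x y by (auto simp: delta_interval_def)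
      fix c d assume cd: "c \<in> T" "d \<in> T" "y \<in> ?J c d"
      have "x < d" using cd up[of d] x y by (force simp: delta_interval_def)
      then show "x \<in> {c..<d}" using y cd by (auto simp: delta_interval_def)
    qed
  qed (use assms J0 in auto)
  finally show "emeasure (delta_measure T) (?J p q) = ennreal (q - p)" .
qed

lemma nabla_measure_interval:
  assumes "time_scale T" "p \<in> T" "q \<in> T" "p \<le> q"
  shows "nabla_interval T p q \<in> sets (nabla_measure T)"
    and "emeasure (nabla_measure T) (nabla_interval T p q) = ennreal (q - p)"
proof -
  let ?J = "nabla_interval T"
  have T: "T \<noteq> {}" "closed T" using assms by (auto simp: time_scale_def)
  have J0: "\<And>c. ?J c c = {}" by (auto simp: nabla_interval_def)
  note oms = length_outer_space[of T ?J, OF T(1) J0]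
  have meas: "{x\<in>T. x \<le> r} \<in> sets (nabla_measure T)" if "r \<in> T" for r
    unfolding nabla_measure_def sets_caratheodory(1)[OF oms]
  proof (rule split_measurable[OF T(1) J0])
    fix c d assume "c \<in> T" "d \<in> T" "c \<le> d"
    then show "\<exists>m\<in>T. c \<le> m \<and> m \<le> d \<and> ?J c d \<inter> {x \<in> T. x \<le> r} \<subseteq> ?J c m
         \<and> ?J c d - {x \<in> T. x \<le> r} \<subseteq> ?J m d"
      using that by (intro bexI[of _ "max c (min d r)"]) (auto simp: nabla_interval_def max_def min_def)
  qed auto
  have "?J p q = {x\<in>T. x \<le> q} - {x\<in>T. x \<le> p}" by (auto simp: nabla_interval_def)
  then show m: "?J p q \<in> sets (nabla_measure T)" using meas assms by auto
  have "emeasure (nabla_measure T) (?J p q) = length_outer T ?J (?J p q)"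
    using m unfolding nabla_measure_def by (simp add: sets_caratheodory[OF oms])
  also have "\<dots> = ennreal (q - p)"
  proof (rule length_outer_interval[where I = "{p<..q}" and I' = "\<lambda>c d. {c<..d}"])
    fix x assume x: "x \<in> {p<..q}"
    define y where "y = Inf (T \<inter> {x..q})"
    have ne: "T \<inter> {x..q} \<noteq> {}" using x assms by auto
    have bd: "bdd_below (T \<inter> {x..q})" by (rule bdd_below_mono[OF bdd_below_Icc Int_lower2])
    have cl: "closed (T \<inter> {x..q})" by (intro closed_Int T closed_atLeastAtMost)
    have y: "y \<in> T \<inter> {x..q}" unfolding y_def by (rule closed_contains_Inf[OF ne bd cl])
    have up: "y \<le> z" if "z \<in> T" "z \<in> {x..q}" for z
      unfolding y_def using that bd by (intro cInf_lower) auto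
    show "\<exists>y\<in>?J p q. \<forall>c\<in>T. \<forall>d\<in>T. y \<in> ?J c d \<longrightarrow> x \<in> {c<..d}"
    proof (intro bexI[of _ y] ballI impI)
      show "y \<in> ?J p q" using x y by (auto simp: nabla_interval_def)
      fix c d assume cd: "c \<in> T" "d \<in> T" "y \<in> ?J c d"
      have "c < x" using cd up[of c] x y by (force simp: nabla_interval_def)
      then show "x \<in> {c<..d}" using y cd by (auto simp: nabla_interval_def)
    qed
  qed (use assms J0 in auto)
  finally show "emeasure (nabla_measure T) (?J p q) = ennreal (q - p)" .
qed

end

theory Submission
  imports Defs
begin

text \<open>
  Put \<open>F = I(\<bar>w\<bar>\<bar>f\<bar>\<^sup>2)\<close>, \<open>G = I(\<bar>w\<bar>\<bar>g\<bar>\<^sup>2)\<close>, \<open>p = \<surd>F\<close>, \<open>q = \<surd>G\<close>. As \<open>I(\<bar>w\<bar>) = 1\<close>, we have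
  \<open>m \<le> p \<le> M\<close> and \<open>n \<le> q \<le> N\<close>, so the normalised functions \<open>\<bar>f\<bar>/p\<close> and \<open>\<bar>g\<bar>/q\<close> take values in
  \<open>[m/M, M/m]\<close> and \<open>[n/N, N/n]\<close>, and differ by at most \<open>D = max (M/m) (N/n) - min (m/M) (n/N)\<close>.
  Integrating \<open>0 \<le> \<bar>w\<bar> (\<bar>f\<bar>/p - \<bar>g\<bar>/q)\<^sup>2 \<le> D\<^sup>2 \<bar>w\<bar>\<close> gives \<open>0 \<le> 2 - 2 I(\<bar>w\<bar>\<bar>f\<bar>\<bar>g\<bar>)/(p q) \<le> D\<^sup>2\<close>.
\<close>

lemma diamond_integrable_add:
  assumes "diamond_integrable T a b u" "diamond_integrable T a b v"
  shows "diamond_integrable T a b (\<lambda>s. u s + v s)"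
  using assms by (auto simp: diamond_integrable_def delta_integrable_def nabla_integrable_def)

lemma diamond_integrable_cmult:
  assumes "diamond_integrable T a b u"
  shows "diamond_integrable T a b (\<lambda>s. c * u s)"
  using assms by (auto simp: diamond_integrable_def delta_integrable_def nabla_integrable_def)

lemma diamond_integral_add:
  assumes "diamond_integrable T a b u" "diamond_integrable T a b v"
  shows "diamond_integral \<alpha> T a b (\<lambda>s. u s + v s)
    = diamond_integral \<alpha> T a b u + diamond_integral \<alpha> T a b v"
  using assms
  by (simp add: diamond_integrable_def delta_integrable_def nabla_integrable_def
      diamond_integral_def delta_integral_def nabla_integral_def set_integral_add algebra_simps)

text \<open>No integrability is assumed: the Bochner integral of a non-integrable function is 0 by
  default, and a nonzero factor does not affect integrability.\<close>

lemma diamond_integral_cmult: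
  "diamond_integral \<alpha> T a b (\<lambda>s. c * u s) = c * diamond_integral \<alpha> T a b u"
  by (simp add: diamond_integral_def delta_integral_def nabla_integral_def algebra_simps)

text \<open>The comparison is made on the closed interval because the delta part sees
  \<open>a\<close> but not \<open>b\<close>, the nabla part \<open>b\<close> but not
  \<open>a\<close>. The bounds on \<open>\<alpha>\<close> make both coefficients
  nonnegative.\<close>

lemma diamond_integral_mono:
  assumes "0 \<le> \<alpha>" "\<alpha> \<le> 1" "diamond_integrable T a b u" "diamond_integrable T a b v"
    and "\<And>s. s \<in> {a..b} \<inter> T \<Longrightarrow> u s \<le> v s"
  shows "diamond_integral \<alpha> T a b u \<le> diamond_integral \<alpha> T a b v"
proof -
  have "delta_integral T a b u \<le> delta_integral T a b v"
    unfolding delta_integral_def using assms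
    by (intro set_integral_mono)
      (auto simp: diamond_integrable_def delta_integrable_def delta_interval_def)
  moreover have "nabla_integral T a b u \<le> nabla_integral T a b v"
    unfolding nabla_integral_def using assms
    by (intro set_integral_mono)
      (auto simp: diamond_integrable_def nabla_integrable_def nabla_interval_def)
  ultimately show ?thesis
    unfolding diamond_integral_def using assms by (intro add_mono mult_left_mono) auto
qed

text \<open>Since \<open>k\<close> has total mass 1, the root is a weighted quadratic mean of
  \<open>u\<close>, so it stays between the bounds of \<open>u\<close>: integrate
  \<open>m\<^sup>2 * k \<le> k * u\<^sup>2 \<le> M\<^sup>2 * k\<close>.\<close>

lemma sqrt_diamond_integral_bounds:
  assumes "0 \<le> \<alpha>" "\<alpha> \<le> 1"
    and "diamond_integrable T a b k" "diamond_integrable T a b (\<lambda>s. k s * (u s)\<^sup>2)"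
    and "diamond_integral \<alpha> T a b k = 1"
    and "\<And>s. s \<in> {a..b} \<inter> T \<Longrightarrow> 0 \<le> k s"
    and "0 \<le> m" "0 \<le> M" "\<And>s. s \<in> {a..b} \<inter> T \<Longrightarrow> m \<le> u s \<and> u s \<le> M"
  shows "m \<le> sqrt (diamond_integral \<alpha> T a b (\<lambda>s. k s * (u s)\<^sup>2))"
    and "sqrt (diamond_integral \<alpha> T a b (\<lambda>s. k s * (u s)\<^sup>2)) \<le> M"
proof -
  have "m\<^sup>2 * k s \<le> k s * (u s)\<^sup>2" "k s * (u s)\<^sup>2 \<le> M\<^sup>2 * k s" if "s \<in> {a..b} \<inter> T" for s
  proof -
    have "0 \<le> k s" "m \<le> u s" "u s \<le> M" using assms that by auto
    then have "m\<^sup>2 \<le> (u s)\<^sup>2" "(u s)\<^sup>2 \<le> M\<^sup>2" using \<open>0 \<le> m\<close> by (auto intro!: power_mono)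
    with \<open>0 \<le> k s\<close> show "m\<^sup>2 * k s \<le> k s * (u s)\<^sup>2" "k s * (u s)\<^sup>2 \<le> M\<^sup>2 * k s"
      by (auto simp: mult.commute[of "k s"] intro: mult_right_mono)
  qed
  then have "diamond_integral \<alpha> T a b (\<lambda>s. m\<^sup>2 * k s) \<le> diamond_integral \<alpha> T a b (\<lambda>s. k s * (u s)\<^sup>2)"
    "diamond_integral \<alpha> T a b (\<lambda>s. k s * (u s)\<^sup>2) \<le> diamond_integral \<alpha> T a b (\<lambda>s. M\<^sup>2 * k s)"
    using assms by (auto intro!: diamond_integral_mono diamond_integrable_cmult)
  then show "m \<le> sqrt (diamond_integral \<alpha> T a b (\<lambda>s. k s * (u s)\<^sup>2))"
    "sqrt (diamond_integral \<alpha> T a b (\<lambda>s. k s * (u s)\<^sup>2)) \<le> M"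
    using assms by (auto simp: diamond_integral_cmult intro: real_le_rsqrt real_le_lsqrt)
qed

text \<open>Kernel and \<open>\<bar>w\<bar>\<close> are merged into one nonnegative weight
  \<open>k\<close> of mass 1, and \<open>\<bar>f\<bar>\<close>, \<open>\<bar>g\<bar>\<close> become
  positive functions \<open>u\<close>, \<open>v\<close>.\<close>

lemma diamond_integral_reverse_Cauchy_Schwarz:
  fixes k u v :: "real \<Rightarrow> real" and m M n N :: real
  defines "D \<equiv> max (M / m) (N / n) - min (m / M) (n / N)"
  assumes \<alpha>: "0 \<le> \<alpha>" "\<alpha> \<le> 1"
    and int: "diamond_integrable T a b k" "diamond_integrable T a b (\<lambda>s. k s * (u s)\<^sup>2)"
      "diamond_integrable T a b (\<lambda>s. k s * (v s)\<^sup>2)" "diamond_integrable T a b (\<lambda>s. k s * (u s * v s))"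
    and one: "diamond_integral \<alpha> T a b k = 1"
    and k: "\<And>s. s \<in> {a..b} \<inter> T \<Longrightarrow> 0 \<le> k s"
    and pos: "0 < m" "0 < M" "0 < n" "0 < N"
    and u: "\<And>s. s \<in> {a..b} \<inter> T \<Longrightarrow> m \<le> u s \<and> u s \<le> M"
    and v: "\<And>s. s \<in> {a..b} \<inter> T \<Longrightarrow> n \<le> v s \<and> v s \<le> N"
  defines "p \<equiv> sqrt (diamond_integral \<alpha> T a b (\<lambda>s. k s * (u s)\<^sup>2))"
    and "q \<equiv> sqrt (diamond_integral \<alpha> T a b (\<lambda>s. k s * (v s)\<^sup>2))"
    and "r \<equiv> diamond_integral \<alpha> T a b (\<lambda>s. k s * (u s * v s))"
  shows "0 \<le> p * q - r" and "p * q - r \<le> 1 / 2 * D\<^sup>2 * (p * q)"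
proof -
  have p: "m \<le> p" "p \<le> M"
    unfolding p_def
    using sqrt_diamond_integral_bounds[OF \<alpha> int(1,2) one k, of m M] u pos by auto
  have q: "n \<le> q" "q \<le> N"
    unfolding q_def
    using sqrt_diamond_integral_bounds[OF \<alpha> int(1,3) one k, of n N] v pos by auto
  have pq: "0 < p" "0 < q" using p q pos by auto
  \<comment> \<open>A positive root forces a positive radicand, so squaring \<open>p\<close> and
    \<open>q\<close> recovers the integrals.\<close>
  have p2: "diamond_integral \<alpha> T a b (\<lambda>s. k s * (u s)\<^sup>2) = p\<^sup>2"
    and q2: "diamond_integral \<alpha> T a b (\<lambda>s. k s * (v s)\<^sup>2) = q\<^sup>2"
    using pq unfolding p_def q_def by auto
  \<comment> \<open>The weighted square in \<open>d_eq\<close>, expanded into the three integrands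
    known to be integrable, so that linearity gives both its integrability and its integral.\<close>
  define d where "d = (\<lambda>s. 1 / p\<^sup>2 * (k s * (u s)\<^sup>2) + 1 / q\<^sup>2 * (k s * (v s)\<^sup>2)
    + (- 2 / (p * q)) * (k s * (u s * v s)))"
  have d_eq: "d s = k s * (u s / p - v s / q)\<^sup>2" for s
    using pq by (simp add: d_def field_simps power2_eq_square)
  have d_int: "diamond_integrable T a b d"
    unfolding d_def using int by (intro diamond_integrable_add diamond_integrable_cmult)
  have "diamond_integral \<alpha> T a b d = 1 / p\<^sup>2 * p\<^sup>2 + 1 / q\<^sup>2 * q\<^sup>2 + (- 2 / (p * q)) * r"
    unfolding d_def r_def using int
    by (simp only: diamond_integral_add diamond_integral_cmult diamond_integrable_add
        diamond_integrable_cmult p2 q2)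
  then have d_val: "diamond_integral \<alpha> T a b d = 2 * (p * q - r) / (p * q)"
    using pq by (simp add: field_simps)
  have d_bounds: "0 \<le> d s" "d s \<le> D\<^sup>2 * k s" if s: "s \<in> {a..b} \<inter> T" for s
  proof -
    show "0 \<le> d s" using k[OF s] by (simp add: d_eq)
    have "m / M \<le> u s / p" "u s / p \<le> M / m" "n / N \<le> v s / q" "v s / q \<le> N / n"
      using u[OF s] v[OF s] p q pos pq by (auto intro!: frac_le)
    \<comment> \<open>Both quotients lie between the minimum and the maximum in \<open>D\<close>, so
      their distance is at most the length of that interval.\<close>
    then have "\<bar>u s / p - v s / q\<bar> \<le> D" unfolding D_def by linarith
    then have "(u s / p - v s / q)\<^sup>2 \<le> D\<^sup>2" by (metis abs_ge_zero power2_abs power_mono)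
    then show "d s \<le> D\<^sup>2 * k s" using k[OF s] by (simp add: d_eq mult.commute mult_left_mono)
  qed
  \<comment> \<open>Writing the lower bound 0 as \<open>0 * k s\<close> lets both comparisons be
    between multiples of \<open>k\<close> and \<open>d\<close>; the mass of \<open>k\<close> then
    turns them into 0 and \<open>D\<^sup>2\<close>.\<close>
  have "diamond_integral \<alpha> T a b (\<lambda>s. 0 * k s) \<le> diamond_integral \<alpha> T a b d"
    "diamond_integral \<alpha> T a b d \<le> diamond_integral \<alpha> T a b (\<lambda>s. D\<^sup>2 * k s)"
    using \<alpha> int d_int d_bounds
    by (intro diamond_integral_mono diamond_integrable_cmult; simp)+
  then have "0 \<le> 2 * (p * q - r) / (p * q)" "2 * (p * q - r) / (p * q) \<le> D\<^sup>2"
    unfolding diamond_integral_cmult d_val one by auto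
  then show "0 \<le> p * q - r" "p * q - r \<le> 1 / 2 * D\<^sup>2 * (p * q)"
    using pq by (auto simp: field_simps zero_le_mult_iff)
qed

theorem corollary3p12:
  fixes T :: "real set" and a b t \<alpha> m M n N :: real
    and w f g :: "real \<Rightarrow> real" and K :: "real \<Rightarrow> real \<Rightarrow> real"
  assumes "time_scale T" and "a \<in> T" and "b \<in> T" and "a < b"
    and "t \<in> {a<..b} \<inter> T"
    and "0 \<le> \<alpha>" and "\<alpha> \<le> 1"
    and "continuous_on ({a..b} \<inter> T) w" and "continuous_on ({a..b} \<inter> T) f"
    and "continuous_on ({a..b} \<inter> T) g"
    and "diamond_integrable T a b w" and "diamond_integrable T a b f"
    and "diamond_integrable T a b g"
    and "\<forall>x\<in>{a..b} \<inter> T. \<forall>s\<in>{a..b} \<inter> T. 0 \<le> K x s"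
    and "kernel_integral_exists T a K (\<lambda>s. \<bar>w s\<bar>) t"
    and "kernel_integral_exists T a K (\<lambda>s. \<bar>w s\<bar> * \<bar>f s\<bar>\<^sup>2) t"
    and "kernel_integral_exists T a K (\<lambda>s. \<bar>w s\<bar> * \<bar>g s\<bar>\<^sup>2) t"
    and "kernel_integral_exists T a K (\<lambda>s. \<bar>w s\<bar> * \<bar>f s\<bar> * \<bar>g s\<bar>) t"
    and "kernel_integral \<alpha> T a K (\<lambda>s. \<bar>w s\<bar>) t = 1"
    and "0 < m" and "0 < M" and "0 < n" and "0 < N"
    and "\<forall>s\<in>{a..t} \<inter> T. m \<le> \<bar>f s\<bar> \<and> \<bar>f s\<bar> \<le> M"
    and "\<forall>s\<in>{a..t} \<inter> T. n \<le> \<bar>g s\<bar> \<and> \<bar>g s\<bar> \<le> N"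
  shows "0 \<le> sqrt (kernel_integral \<alpha> T a K (\<lambda>s. \<bar>w s\<bar> * \<bar>f s\<bar>\<^sup>2) t)
              * sqrt (kernel_integral \<alpha> T a K (\<lambda>s. \<bar>w s\<bar> * \<bar>g s\<bar>\<^sup>2) t)
            - kernel_integral \<alpha> T a K (\<lambda>s. \<bar>w s\<bar> * \<bar>f s\<bar> * \<bar>g s\<bar>) t
       \<and> sqrt (kernel_integral \<alpha> T a K (\<lambda>s. \<bar>w s\<bar> * \<bar>f s\<bar>\<^sup>2) t)
              * sqrt (kernel_integral \<alpha> T a K (\<lambda>s. \<bar>w s\<bar> * \<bar>g s\<bar>\<^sup>2) t)
            - kernel_integral \<alpha> T a K (\<lambda>s. \<bar>w s\<bar> * \<bar>f s\<bar> * \<bar>g s\<bar>) t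
         \<le> 1 / 2 * (max (M / m) (N / n) - min (m / M) (n / N))\<^sup>2
            * (sqrt (kernel_integral \<alpha> T a K (\<lambda>s. \<bar>w s\<bar> * \<bar>f s\<bar>\<^sup>2) t)
              * sqrt (kernel_integral \<alpha> T a K (\<lambda>s. \<bar>w s\<bar> * \<bar>g s\<bar>\<^sup>2) t))"
proof -
  have t: "a < t" "t \<le> b" "t \<in> T" using assms(5) by auto
  \<comment> \<open>The upper limit is \<open>t\<close>, and \<open>t \<le> b\<close> with
    \<open>t \<in> T\<close> makes \<open>K t s\<close> nonnegative on all of
    \<open>{a..t} \<inter> T\<close>.\<close>
  show ?thesis
    using diamond_integral_reverse_Cauchy_Schwarz[of \<alpha> T a t "\<lambda>s. K t s * \<bar>w s\<bar>"
        "\<lambda>s. \<bar>f s\<bar>" "\<lambda>s. \<bar>g s\<bar>" m M n N] assms t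
    by (simp add: kernel_integral_exists_def kernel_integral_def mult.assoc)
qed

end
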